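(* Let $q$ be a complex number with $|q|<1$, fix a choice of $q^{1/4}$, and set $q^{r/4}:=(q^{1/4})^r$ for integers $r$. For $k=1,2,\dots,8$ define \[ X_k(q):=q^{(2k-1)/4}\,\frac{(q^{9-k},q^{25+k};q^{34})_\infty}{(q^{8+k},q^{26-k};q^{34})_\infty} = q^{(2k-1)/4}\,\frac{f(-q^{9-k},-q^{25+k})}{f(-q^{8+k},-q^{26-k})}. \] (So $X_1(q)=q^{1/4}f(-q^8,-q^{26})/f(-q^9,-q^{25})$, $X_2(q)=q^{3/4}f(-q^7,-q^{27})/f(-q^{10},-q^{24})$, \dots, $X_8(q)=q^{15/4}f(-q,-q^{33})/f(-q^{16},-q^{18})$.) Then for each $k=1,\dots,8$, \[ \frac{1}{X_k(q)}+X_k(q)=\frac{\phi(-q^{17/2})\,f\!\left(q^{(2k-1)/2},\,q^{(35-2k)/2}\right)}{q^{(2k-1)/4}\,\psi(q^{17})\,f(-q^{9-k},-q^{8+k})}, \] \[ \frac{1}{X_k(q)}-X_k(q)=\frac{\phi(q^{17/2})\,f\!\left(-q^{(2k-1)/2},\,-q^{(35-2k)/2}\right)}{q^{(2k-1)/4}\,\psi(q^{17})\,f(-q^{9-k},-q^{8+k})}. \]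
   Context: For complex $\lambda$ and $|q|<1$, $(\lambda;q)_\infty=\prod_{n\ge0}(1-\lambda q^n)$ and $(\lambda_1,\dots,\lambda_l;q)_\infty=\prod_{i}(\lambda_i;q)_\infty$. Ramanujan's general theta function is $f(a,b)=\sum_{n=-\infty}^{\infty}a^{n(n+1)/2}b^{n(n-1)/2}$ for $|ab|<1$, with $\phi(q)=f(q,q)=\sum_{n}q^{n^2}$ and $\psi(q)=f(q,q^3)=\sum_{n\ge0}q^{n(n+1)/2}$. Fractional powers of $q$ appearing in arguments (e.g. $q^{17/2}$, $q^{(2k-1)/2}$) are the corresponding powers of the fixed $q^{1/4}$. *)

theory Defs
  imports "HOL-Analysis.Analysis"
begin

text \<open>The infinite product converges (in the sense of \<open>has_prod\<close>, which allows zero factors)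
  for every \<open>a\<close> as soon as \<open>norm q < 1\<close>.\<close>
definition qpoch_inf :: "complex \<Rightarrow> complex \<Rightarrow> complex" where
  "qpoch_inf a q = (\<Prod>n. 1 - a * q ^ n)"

definition qpoch_inf_list :: "complex list \<Rightarrow> complex \<Rightarrow> complex" where
  "qpoch_inf_list as q = (\<Prod>a\<leftarrow>as. qpoch_inf a q)"

text \<open>Ramanujan's general theta function, an absolutely convergent bilateral series for
  \<open>norm (a * b) < 1\<close>. Both exponents are nonnegative integers and both divisions are exact.\<close>
definition ramanujan_f :: "complex \<Rightarrow> complex \<Rightarrow> complex" where
  "ramanujan_f a b =
     (\<Sum>\<^sub>\<infinity>n\<in>(UNIV :: int set). a powi (n * (n + 1) div 2) * b powi (n * (n - 1) div 2))"

definition ramanujan_phi :: "complex \<Rightarrow> complex" where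
  "ramanujan_phi q = ramanujan_f q q"

definition ramanujan_psi :: "complex \<Rightarrow> complex" where
  "ramanujan_psi q = ramanujan_f q (q ^ 3)"

text \<open>The argument \<open>t\<close> is the chosen fourth root of \<open>q\<close>, so that \<open>t ^ r\<close> is the \<open>r/4\<close>-th power
  of \<open>q\<close>. Only \<open>1 \<le> k \<le> 8\<close> is meant; there no natural-number subtraction truncates.\<close>
definition X_quot :: "complex \<Rightarrow> complex \<Rightarrow> nat \<Rightarrow> complex" where
  "X_quot q t k = t ^ (2 * k - 1) *
     (qpoch_inf_list [q ^ (9 - k), q ^ (25 + k)] (q ^ 34) /
      qpoch_inf_list [q ^ (8 + k), q ^ (26 - k)] (q ^ 34))"

end

theory Submission
  imports Defs
begin

text \<open>With \<open>theta Q a = (\<Sum>n. Q powi (n (n - 1) / 2) * a powi n)\<close> one has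
  \<open>f(a, b) = theta (a b) a\<close>. Substituting \<open>m = s + r\<close>, \<open>n = s - r\<close> (or \<open>m = s + r + 1\<close>) in the
  double series turns a product of two theta series with base \<open>Q\<close> into a sum of two products with
  base \<open>Q\<^sup>2\<close>. Put \<open>A = f(-a, -p / a)\<close>, \<open>B = f(-b, -p / b)\<close> with \<open>p = q^34\<close>,
  \<open>a = q^(9 - k)\<close>, \<open>b = q^(8 + k)\<close>, so that \<open>X = x A / B\<close> and
  \<open>1 / X \<plusminus> X = (B\<^sup>2 \<plusminus> x\<^sup>2 A\<^sup>2) / (x A B)\<close>. The substitution factors the denominator as
  \<open>A B = \<psi>(q^17) f(-a, -b)\<close>; expanding both squares in the numerator produces the same two theta
  series, and the numerator factors. The Jacobi triple product, obtained from the finite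
  \<open>q\<close>-binomial theorem by dominated convergence, gives the product form of \<open>X\<close> and
  \<open>A, B \<noteq> 0\<close>.\<close>

section \<open>Theta series: exponents, convergence and symmetry\<close>

definition tri :: "int \<Rightarrow> int" where
  "tri n = n * (n - 1) div 2"

definition theta_term :: "complex \<Rightarrow> complex \<Rightarrow> int \<Rightarrow> complex" where
  "theta_term Q a n = Q powi tri n * a powi n"

definition theta :: "complex \<Rightarrow> complex \<Rightarrow> complex" where
  "theta Q a = (\<Sum>\<^sub>\<infinity>n. theta_term Q a n)"

text \<open>One of two consecutive integers is even, so the division in \<open>tri\<close> is exact.
  The later identities for \<open>tri\<close> are obtained by doubling and comparing
  polynomials.\<close>

lemma two_tri: "2 * tri n = n * (n - 1)"
  unfolding tri_def by (rule dvd_mult_div_cancel) auto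

lemma tri_of_nat_Suc: "tri (int (Suc n)) = tri (int n) + int n"
  using two_tri[of "int (Suc n)"] two_tri[of "int n"] by (simp add: algebra_simps)

lemma tri_uminus: "tri (- n) = tri n + n"
  using two_tri[of "- n"] two_tri[of n] by (simp add: algebra_simps)

lemma tri_plus_1: "tri (n + 1) = tri n + n"
  using two_tri[of "n + 1"] two_tri[of n] by (simp add: algebra_simps)

lemma tri_double: "tri (2 * n) = 4 * tri n + n"
  using two_tri[of "2 * n"] two_tri[of n] by (simp add: algebra_simps)

lemma tri_double_plus_1: "tri (2 * n + 1) = 4 * tri n + 3 * n"
  using two_tri[of "2 * n + 1"] two_tri[of n] by (simp add: algebra_simps)

text \<open>The mixed terms in \<open>s * r\<close> cancel; this is what lets a double theta series
  decouple into a product in \<open>s\<close> and \<open>r\<close>.\<close>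

lemma tri_sum_diff: "tri (s + r) + tri (s - r) = 2 * tri s + (2 * tri r + r)"
  using two_tri[of "s + r"] two_tri[of "s - r"] two_tri[of r] two_tri[of s]
  by (simp add: algebra_simps)

lemma tri_sum_diff_odd: "tri (s + r + 1) + tri (s - r) = 2 * tri s + s + (2 * tri r + 2 * r)"
  using tri_sum_diff[of s r] tri_plus_1[of "s + r"] by simp

lemma powi_mult2: "(x::complex) powi (2 * n) = (x ^ 2) powi n"
  by (simp add: power_int_mult)

lemma powi_mult4: "(x::complex) powi (4 * n) = (x ^ 4) powi n"
  by (simp add: power_int_mult)

lemma powi_mult3: "(x::complex) powi (3 * n) = (x ^ 3) powi n"
  by (simp add: power_int_mult)

text \<open>Consecutive terms have ratio \<open>r ^ n * c\<close>, which tends to 0, so the ratio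
  test applies however large \<open>c\<close> is.\<close>

lemma summable_geometric_tri:
  fixes r c :: real
  assumes "0 < r" "r < 1" "0 < c"
  shows "(\<lambda>n. r powi tri (int n) * c powi int n) summable_on UNIV"
proof (rule summable_nonneg_imp_summable_on)
  have "(\<lambda>n. r ^ n * c) \<longlonglongrightarrow> 0 * c"
    by (intro tendsto_mult_right LIMSEQ_realpow_zero) (use assms in auto)
  then have "eventually (\<lambda>n. r ^ n * c < 1 / 2) sequentially"
    by (rule order_tendstoD) auto
  then obtain N where N: "\<And>n. n \<ge> N \<Longrightarrow> r ^ n * c < 1 / 2"
    unfolding eventually_sequentially by blast
  show "summable (\<lambda>n. r powi tri (int n) * c powi int n)"
  proof (rule summable_ratio_test)
    fix n assume n: "n \<ge> N"
    have "norm (r powi tri (int (Suc n)) * c powi int (Suc n)) =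
        (r ^ n * c) * (r powi tri (int n) * c powi int n)"
      unfolding tri_of_nat_Suc using assms
      by (simp add: power_int_add abs_mult power_int_abs)
    also have "\<dots> \<le> 1 / 2 * (r powi tri (int n) * c powi int n)"
      by (intro mult_right_mono) (use assms N[OF n] in auto)
    finally show "norm (r powi tri (int (Suc n)) * c powi int (Suc n)) \<le>
        1 / 2 * norm (r powi tri (int n) * c powi int n)"
      using assms by (simp add: abs_mult power_int_abs)
  qed simp
qed (use assms in auto)

text \<open>The integers are covered by two half-lines. On the negative one,
  \<open>tri_uminus\<close> turns the terms into the same one-sided series with \<open>c\<close>
  replaced by \<open>r / c\<close>.\<close>

lemma abs_summable_theta_term:
  assumes "Q \<noteq> 0" "norm Q < 1" "a \<noteq> 0"
  shows "(\<lambda>n. norm (theta_term Q a n)) summable_on UNIV"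
proof -
  let ?r = "norm Q" and ?c = "norm a"
  have pos: "(\<lambda>n. norm (theta_term Q a n)) summable_on range int"
    by (subst summable_on_reindex)
      (use assms summable_geometric_tri[of ?r ?c]
        in \<open>auto simp: o_def theta_term_def norm_mult norm_power_int\<close>)
  have "norm (theta_term Q a (- int n)) = ?r powi tri (int n) * (?r / ?c) powi int n" for n
    using assms
    by (simp add: theta_term_def norm_mult norm_power_int tri_uminus power_int_add
        power_int_minus norm_power norm_inverse divide_inverse power_mult_distrib power_inverse)
  moreover have "inj (\<lambda>n. - int n)"
    by (auto simp: inj_on_def)
  ultimately have neg: "(\<lambda>n. norm (theta_term Q a n)) summable_on range (\<lambda>n. - int n)"
    using assms summable_geometric_tri[of ?r "?r / ?c"]
    by (subst summable_on_reindex) (auto simp: o_def)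
  have "range int \<union> range (\<lambda>n. - int n) = UNIV"
    by (auto simp: image_iff) (metis int_cases2)
  then show ?thesis
    using summable_on_union[OF pos neg] by simp
qed

lemma has_sum_theta:
  assumes "Q \<noteq> 0" "norm Q < 1" "a \<noteq> 0"
  shows "(theta_term Q a has_sum theta Q a) UNIV"
  unfolding theta_def
  by (rule has_sum_infsum, rule abs_summable_summable) (rule abs_summable_theta_term[OF assms])

lemma ramanujan_f_eq_theta:
  assumes "a \<noteq> 0" "b \<noteq> 0"
  shows "ramanujan_f a b = theta (a * b) a"
proof -
  have "a powi (n * (n + 1) div 2) * b powi (n * (n - 1) div 2) = theta_term (a * b) a n" for n
  proof -
    have "n * (n + 1) div 2 = tri n + n"
      using tri_plus_1[of n] by (simp add: tri_def mult.commute)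
    then show ?thesis
      using assms by (simp add: theta_term_def power_int_add power_int_mult_distrib flip: tri_def)
  qed
  then show ?thesis
    unfolding ramanujan_f_def theta_def by simp
qed

text \<open>Reverse the index: the extra \<open>n\<close> in \<open>tri_uminus\<close> is absorbed
  by the numerator of \<open>Q / a\<close>. This is the symmetry f(a, b) = f(b, a).\<close>

lemma theta_reflect:
  assumes "Q \<noteq> 0" "norm Q < 1" "a \<noteq> 0"
  shows "theta Q (Q / a) = theta Q a"
proof -
  have "theta_term Q (Q / a) n = theta_term Q a (- n)" for n
    using assms by (simp add: theta_term_def tri_uminus power_int_add power_int_divide_distrib
        power_int_minus field_simps)
  then have "theta Q (Q / a) = (\<Sum>\<^sub>\<infinity>n. theta_term Q a (- n))"
    by (simp add: theta_def)
  also have "\<dots> = theta Q a"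
    unfolding theta_def by (rule infsum_reindex_bij_betw) (rule bij_uminus)
  finally show ?thesis .
qed

section \<open>Parity splitting and products of theta series\<close>

lemma has_sum_even_odd:
  fixes f :: "int \<Rightarrow> complex"
  assumes "((\<lambda>n. f (2 * n)) has_sum A) UNIV" "((\<lambda>n. f (2 * n + 1)) has_sum B) UNIV"
  shows "(f has_sum (A + B)) UNIV"
proof -
  have "(f has_sum A) {n. even n}"
    using assms(1) by (subst has_sum_reindex_bij_witness[of _ "\<lambda>n. 2 * n" "\<lambda>n. n div 2"]) auto
  moreover have "(f has_sum B) {n. odd n}"
    using assms(2)
    by (subst has_sum_reindex_bij_witness[of _ "\<lambda>n. 2 * n + 1" "\<lambda>n. n div 2"]) auto
  ultimately have "(f has_sum (A + B)) ({n. even n} \<union> {n. odd n})"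
    by (rule has_sum_Un_disjoint) auto
  also have "{n. even n} \<union> {n. odd n} = (UNIV :: int set)"
    by auto
  finally show ?thesis .
qed

text \<open>Split by the parity of the index; \<open>tri_double\<close> and
  \<open>tri_double_plus_1\<close> show that each half is a theta series with base
  \<open>Q ^ 4\<close>.\<close>

lemma theta_even_odd:
  assumes "Q \<noteq> 0" "norm Q < 1" "a \<noteq> 0"
  shows "theta Q a = theta (Q ^ 4) (Q * a ^ 2) + a * theta (Q ^ 4) (Q ^ 3 * a ^ 2)"
proof -
  have Q4: "norm (Q ^ 4) < 1"
    using assms by (simp add: norm_power power_less_one_iff)
  have even: "theta_term Q a (2 * n) = theta_term (Q ^ 4) (Q * a ^ 2) n" for n
    using assms by (simp add: theta_term_def tri_double power_int_add powi_mult4 powi_mult2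
        power_int_mult_distrib)
  have odd: "theta_term Q a (2 * n + 1) = a * theta_term (Q ^ 4) (Q ^ 3 * a ^ 2) n" for n
    using assms by (simp add: theta_term_def tri_double_plus_1 power_int_add powi_mult4
        powi_mult2 powi_mult3 power_int_mult_distrib)
  have "(theta_term Q a has_sum
      (theta (Q ^ 4) (Q * a ^ 2) + a * theta (Q ^ 4) (Q ^ 3 * a ^ 2))) UNIV"
    unfolding even odd using assms Q4
    by (intro has_sum_even_odd) (auto simp: even odd intro!: has_sum_cmult_right has_sum_theta)
  then show ?thesis
    using has_sum_unique has_sum_theta[OF assms] by blast
qed

lemma has_sum_product_complex:
  fixes f :: "'a \<Rightarrow> complex" and g :: "'b \<Rightarrow> complex"
  assumes f: "(\<lambda>x. norm (f x)) summable_on A" "(f has_sum F) A"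
    and g: "(\<lambda>x. norm (g x)) summable_on B" "(g has_sum G) B"
  shows "((\<lambda>(x, y). f x * g y) has_sum (F * G)) (A \<times> B)"
proof (rule has_sum_SigmaI)
  show "((\<lambda>y. case (x, y) of (x, y) \<Rightarrow> f x * g y) has_sum f x * G) B" for x
    using has_sum_cmult_right[OF g(2)] by simp
  show "((\<lambda>x. f x * G) has_sum F * G) A"
    by (rule has_sum_cmult_left[OF f(2)])
  have "(\<lambda>z. norm (case z of (x, y) \<Rightarrow> f x * g y)) summable_on A \<times> B"
    unfolding Infinite_Sum.abs_summable_on_Sigma_iff using f(1) g(1)
    by (auto simp: norm_mult infsum_cmult_right' abs_mult infsum_nonneg
        intro!: summable_on_cmult_right summable_on_cmult_left)
  then show "(\<lambda>(x, y). f x * g y) summable_on A \<times> B"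
    by (rule abs_summable_summable)
qed

lemma half_sum_diff:
  fixes u v :: int
  assumes "even u = even v"
  shows "(u + v) div 2 + (u - v) div 2 = u" "(u + v) div 2 - (u - v) div 2 = v"
  using assms by presburger+

text \<open>For \<open>u = s + r + 1\<close> and \<open>v = s - r\<close>, both \<open>u + v\<close>
  and \<open>u - v\<close> exceed an even number by 1. Rounding down still recovers \<open>s\<close>
  and \<open>r\<close>, so the inverse map is the same as for equal parities.\<close>

lemma half_sum_diff_odd:
  fixes u v :: int
  assumes "even u \<noteq> even v"
  shows "(u + v) div 2 + (u - v) div 2 + 1 = u" "(u + v) div 2 - (u - v) div 2 = v"
  using assms by presburger+

text \<open>Pairs with even sum are exactly the \<open>(s + r, s - r)\<close>, those with odd sum
  the \<open>(s + r + 1, s - r)\<close>. In each class the exponent decouples, and the shift by 1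
  leaves the factor \<open>a\<close> in front.\<close>

lemma theta_mult_theta:
  assumes Q: "Q \<noteq> 0" "norm Q < 1" and ab: "a \<noteq> 0" "b \<noteq> 0"
  shows "theta Q a * theta Q b =
    theta (Q ^ 2) (a * b) * theta (Q ^ 2) (Q * a / b) +
    a * (theta (Q ^ 2) (Q * a * b) * theta (Q ^ 2) (Q ^ 2 * a / b))"
    (is "_ = ?A * ?B + a * (?C * ?D)")
proof -
  have Q2: "Q ^ 2 \<noteq> 0" "norm (Q ^ 2) < 1"
    using Q by (auto simp: norm_power power_less_one_iff)
  define h where "h = (\<lambda>(m, n). theta_term Q a m * theta_term Q b n)"
  have prod: "((\<lambda>(m, n). theta_term R c m * theta_term R d n) has_sum (theta R c * theta R d))
      (UNIV \<times> UNIV)" if "R \<noteq> 0" "norm R < 1" "c \<noteq> 0" "d \<noteq> 0" for R c d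
    by (intro has_sum_product_complex abs_summable_theta_term has_sum_theta that)
  have prod_term: "theta_term Q a m * theta_term Q b n =
      Q powi (tri m + tri n) * a powi m * b powi n" for m n
    using Q by (simp add: theta_term_def power_int_add)
  have even: "h (s + r, s - r) = theta_term (Q ^ 2) (a * b) s * theta_term (Q ^ 2) (Q * a / b) r"
    for s r
    unfolding h_def case_prod_conv prod_term tri_sum_diff using assms
    by (simp add: theta_term_def power_int_add power_int_diff power_int_mult_distrib
        power_int_divide_distrib powi_mult2)
  have odd: "h (s + r + 1, s - r) =
      a * (theta_term (Q ^ 2) (Q * a * b) s * theta_term (Q ^ 2) (Q ^ 2 * a / b) r)" for s r
    unfolding h_def case_prod_conv prod_term tri_sum_diff_odd using assms
    by (simp add: theta_term_def power_int_add power_int_diff power_int_mult_distrib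
        power_int_divide_distrib powi_mult2)
  have "((\<lambda>(s, r). h (s + r, s - r)) has_sum ?A * ?B) (UNIV \<times> UNIV)"
    unfolding even using assms Q2 by (intro prod) auto
  then have E: "(h has_sum ?A * ?B) {(m, n). even (m + n)}"
    by (subst has_sum_reindex_bij_witness[of _ "\<lambda>(s, r). (s + r, s - r)"
          "\<lambda>(m, n). ((m + n) div 2, (m - n) div 2)" _ "\<lambda>(s, r). h (s + r, s - r)"]) 
       (auto simp: half_sum_diff)
  have "((\<lambda>(s, r). h (s + r + 1, s - r)) has_sum a * (?C * ?D)) (UNIV \<times> UNIV)"
    unfolding odd case_prod_unfold
    by (intro has_sum_cmult_right prod[unfolded case_prod_unfold]) (use assms Q2 in auto)
  then have O: "(h has_sum a * (?C * ?D)) {(m, n). odd (m + n)}"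
    by (subst has_sum_reindex_bij_witness[of _ "\<lambda>(s, r). (s + r + 1, s - r)"
          "\<lambda>(m, n). ((m + n) div 2, (m - n) div 2)" _ "\<lambda>(s, r). h (s + r + 1, s - r)"]) 
       (auto simp: half_sum_diff_odd)
  have "(h has_sum (?A * ?B + a * (?C * ?D))) ({(m, n). even (m + n)} \<union> {(m, n). odd (m + n)})"
    by (rule has_sum_Un_disjoint[OF E O]) auto
  also have "{(m, n). even (m + n)} \<union> {(m, n). odd (m + n)} = (UNIV \<times> UNIV :: (int \<times> int) set)"
    by auto
  finally show ?thesis
    using prod[OF Q ab] has_sum_unique unfolding h_def by blast
qed

section \<open>The q-binomial theorem and the finite triple product\<close>

definition qpoch :: "complex \<Rightarrow> complex \<Rightarrow> nat \<Rightarrow> complex" where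
  "qpoch a p n = (\<Prod>i<n. 1 - a * p ^ i)"

text \<open>Gaussian binomial coefficients through a q-Pascal rule, hence polynomials in
  \<open>p\<close> without denominators. The subtraction \<open>n - j\<close> truncates only for
  \<open>j > n\<close>, where the coefficient next to it is 0.\<close>

fun qbinomial :: "complex \<Rightarrow> nat \<Rightarrow> nat \<Rightarrow> complex" where
  "qbinomial p n 0 = 1"
| "qbinomial p 0 (Suc j) = 0"
| "qbinomial p (Suc n) (Suc j) = qbinomial p n (Suc j) + p ^ (n - j) * qbinomial p n j"

lemma qbinomial_eq_0: "n < j \<Longrightarrow> qbinomial p n j = 0"
  by (induction p n j rule: qbinomial.induct) auto

lemma qpoch_0 [simp]: "qpoch a p 0 = 1"
  by (simp add: qpoch_def)

lemma qpoch_Suc: "qpoch a p (Suc n) = qpoch a p n * (1 - a * p ^ n)"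
  by (simp add: qpoch_def)

text \<open>The q-factorial formula with denominators cleared. With \<open>n = i + d + 1\<close>,
  the two Pascal terms contribute \<open>1 - p ^ (d + 1)\<close> and
  \<open>p ^ (d + 1) * (1 - p ^ (i + 1))\<close>, which add up to the new factor
  \<open>1 - p ^ (n + 1)\<close>.\<close>

lemma qbinomial_mult_qpoch:
  "j \<le> n \<Longrightarrow> qbinomial p n j * qpoch p p j * qpoch p p (n - j) = qpoch p p n"
proof (induction n arbitrary: j)
  case (Suc n)
  show ?case
  proof (cases j)
    case (Suc i)
    show ?thesis
    proof (cases "i = n")
      case True
      have "qbinomial p (Suc n) j * qpoch p p j * qpoch p p (Suc n - j) =
          (qbinomial p n n * qpoch p p n * qpoch p p (n - n)) * (1 - p * p ^ n)"
        using True Suc by (simp add: qbinomial_eq_0 qpoch_Suc)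
      then show ?thesis
        using Suc.IH[of n] by (simp only: order_refl qpoch_Suc)
    next
      case False
      with Suc Suc.prems have i: "i < n" by simp
      then obtain d where d: "n = Suc (i + d)"
        using less_iff_Suc_add by auto
      have "qbinomial p n (Suc i) * qpoch p p (Suc i) * qpoch p p d = qpoch p p n"
        using Suc.IH[of "Suc i"] i d by simp
      moreover have "qbinomial p n i * qpoch p p i * qpoch p p (Suc d) = qpoch p p n"
        using Suc.IH[of i] i d by simp
      moreover have "qbinomial p (Suc n) j * qpoch p p j * qpoch p p (Suc n - j) =
          (qbinomial p n (Suc i) * qpoch p p (Suc i) * qpoch p p d) * (1 - p ^ Suc d) +
          p ^ Suc d * (1 - p ^ Suc i) * (qbinomial p n i * qpoch p p i * qpoch p p (Suc d))"
        using Suc d by (simp add: qpoch_Suc algebra_simps)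
      ultimately have "qbinomial p (Suc n) j * qpoch p p j * qpoch p p (Suc n - j) =
          qpoch p p n * (1 - p ^ Suc d) + p ^ Suc d * (1 - p ^ Suc i) * qpoch p p n"
        by simp
      also have "\<dots> = qpoch p p (Suc n)"
        using d by (simp add: qpoch_Suc algebra_simps power_add)
      finally show ?thesis .
    qed
  qed auto
qed auto

text \<open>By the Pascal rule, passing from \<open>n\<close> to \<open>n + 1\<close> adds to each
  term \<open>p ^ n * x\<close> times the preceding one, which is multiplication by the new factor
  \<open>1 + x * p ^ n\<close>.\<close>

theorem qbinomial_theorem:
  assumes "p \<noteq> 0"
  shows "(\<Prod>i<n. 1 + x * p ^ i) = (\<Sum>j\<le>n. qbinomial p n j * p powi tri (int j) * x ^ j)"
proof (induction n)
  case 0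
  show ?case by (simp add: tri_def)
next
  case (Suc n)
  let ?h = "\<lambda>n j. qbinomial p n j * p powi tri (int j) * x ^ j"
  have step: "?h (Suc n) (Suc j) = ?h n (Suc j) + p ^ n * x * ?h n j" if "j \<le> n" for j
  proof -
    have "p ^ n = p ^ (n - j) * p ^ j"
      using that by (simp flip: power_add)
    then show ?thesis
      using assms unfolding tri_of_nat_Suc by (simp add: power_int_add algebra_simps)
  qed
  have "(\<Sum>j\<le>Suc n. ?h (Suc n) j) = ?h (Suc n) 0 + (\<Sum>j\<le>n. ?h (Suc n) (Suc j))"
    by (rule sum.atMost_Suc_shift)
  also have "\<dots> = (?h n 0 + (\<Sum>j\<le>n. ?h n (Suc j))) + p ^ n * x * (\<Sum>j\<le>n. ?h n j)"
    using step by (simp add: sum.distrib sum_distrib_left)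
  also have "?h n 0 + (\<Sum>j\<le>n. ?h n (Suc j)) = (\<Sum>j\<le>Suc n. ?h n j)"
    by (rule sum.atMost_Suc_shift[symmetric])
  also have "\<dots> = (\<Sum>j\<le>n. ?h n j)"
    by (simp add: qbinomial_eq_0)
  finally show ?case
    using Suc by (simp add: algebra_simps)
qed

text \<open>Each factor is \<open>1 - a / p ^ m\<close> with \<open>m\<close> from 1 to
  \<open>n\<close>. Extracting \<open>- a / p ^ m\<close> leaves \<open>1 - p ^ m / a\<close>, a
  factor of \<open>qpoch (p / a) p n\<close>; the extracted exponents sum to
  \<open>tri n + n\<close>.\<close>

lemma prod_reflect:
  assumes "p \<noteq> 0" "a \<noteq> 0"
  shows "(\<Prod>i<n. 1 + (- a / p ^ n) * p ^ i) =
    (- a) ^ n * p powi (- (tri (int n) + int n)) * qpoch (p / a) p n"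
proof (induction n)
  case 0
  show ?case by (simp add: tri_def)
next
  case (Suc n)
  \<comment> \<open>The argument also depends on \<open>n\<close>, so the new factor appears at
    index 0 and the others shift by one.\<close>
  have "(\<Prod>i<Suc n. 1 + (- a / p ^ Suc n) * p ^ i) =
      (1 - a / p ^ Suc n) * (\<Prod>i<n. 1 + (- a / p ^ n) * p ^ i)"
    unfolding prod.lessThan_Suc_shift using assms by simp
  moreover have "1 - a / p ^ Suc n = - a / p ^ Suc n * (1 - p / a * p ^ n)"
    using assms by (simp add: field_simps)
  moreover have "p powi (- (tri (int (Suc n)) + int (Suc n))) =
      p powi (- (tri (int n) + int n)) / p ^ Suc n"
  proof -
    have "- (tri (int (Suc n)) + int (Suc n)) = - (tri (int n) + int n) - int (Suc n)"
      unfolding tri_of_nat_Suc by simp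
    then show ?thesis
      using assms by (simp only: power_int_diff power_int_of_nat simp_thms)
  qed
  ultimately show ?case
    unfolding Suc.IH by (simp add: qpoch_Suc)
qed

lemma prod_lessThan_add:
  fixes f :: "nat \<Rightarrow> 'a :: comm_monoid_mult"
  shows "(\<Prod>i<m + n. f i) = (\<Prod>i<m. f i) * (\<Prod>i<n. f (m + i))"
  by (induction n) (auto simp: mult.assoc)

text \<open>Take \<open>2 * n\<close> factors and \<open>x = - a / p ^ n\<close> in the q-binomial
  theorem: the first \<open>n\<close> factors reflect to \<open>qpoch (p / a) p n\<close>, the last
  \<open>n\<close> form \<open>qpoch a p n\<close>, and \<open>j = n + k\<close> centres the
  sum.\<close>

lemma finite_jacobi_triple_product:
  assumes "p \<noteq> 0" "a \<noteq> 0"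
  shows "qpoch a p n * qpoch (p / a) p n =
    (\<Sum>k\<in>{- int n..int n}. qbinomial p (2 * n) (nat (int n + k)) * theta_term p (- a) k)"
proof -
  \<comment> \<open>The monomial extracted by \<open>prod_reflect\<close>; it is cancelled at the
    end.\<close>
  define c where "c = (- a) ^ n * p powi (- (tri (int n) + int n))"
  have c: "c \<noteq> 0"
    using assms by (simp add: c_def)
  have "c * (qpoch a p n * qpoch (p / a) p n) =
      (\<Prod>i<n. 1 + (- a / p ^ n) * p ^ i) * (\<Prod>i<n. 1 + (- a / p ^ n) * p ^ (n + i))"
    unfolding prod_reflect[OF assms] c_def using assms by (simp add: qpoch_def power_add)
  also have "\<dots> = (\<Prod>i<2 * n. 1 + (- a / p ^ n) * p ^ i)"
    by (simp only: mult_2 prod_lessThan_add)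
  also have "\<dots> = (\<Sum>j\<le>2 * n. qbinomial p (2 * n) j * p powi tri (int j) * (- a / p ^ n) ^ j)"
    by (rule qbinomial_theorem[OF assms(1)])
  also have "\<dots> = (\<Sum>k\<in>{- int n..int n}.
      c * (qbinomial p (2 * n) (nat (int n + k)) * theta_term p (- a) k))"
  proof (rule sum.reindex_bij_witness[of _ "\<lambda>k. nat (int n + k)" "\<lambda>j. int j - int n"])
    fix j assume "j \<in> {..2 * n}"
    have "tri (int j - int n) + - (tri (int n) + int n) = tri (int j) - int n * int j"
      using two_tri[of "int j - int n"] two_tri[of "int n"] two_tri[of "int j"]
      by (simp add: algebra_simps)
    then have exps: "p powi tri (int j - int n) * p powi (- (tri (int n) + int n)) =
        p powi tri (int j) / (p ^ n) ^ j"
      using assms by (subst power_int_add[symmetric])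
        (simp_all only: power_int_diff power_int_mult power_int_of_nat simp_thms)
    have signs: "(- a) ^ n * (- a) powi (int j - int n) = (- a) ^ j"
      using assms by (simp add: power_int_diff)
    have "c * (qbinomial p (2 * n) j * theta_term p (- a) (int j - int n)) =
        qbinomial p (2 * n) j *
        (p powi tri (int j - int n) * p powi (- (tri (int n) + int n))) *
        ((- a) ^ n * (- a) powi (int j - int n))"
      by (simp only: c_def theta_term_def mult_ac)
    also have "\<dots> = qbinomial p (2 * n) j * p powi tri (int j) * (- a / p ^ n) ^ j"
      unfolding exps signs power_divide by simp
    finally show "c * (qbinomial p (2 * n) (nat (int n + (int j - int n))) *
        theta_term p (- a) (int j - int n)) =
        qbinomial p (2 * n) j * p powi tri (int j) * (- a / p ^ n) ^ j"
      by simp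
  qed auto
  finally show ?thesis
    using c by (simp flip: sum_distrib_left)
qed

section \<open>Infinite products and the Jacobi triple product\<close>

lemma convergent_prod_qpoch:
  fixes a p :: complex
  assumes "norm p < 1"
  shows "convergent_prod (\<lambda>n. 1 - a * p ^ n)"
proof -
  have "summable (\<lambda>n. norm a * norm p ^ n)"
    using assms by (intro summable_mult summable_geometric) auto
  then have "abs_convergent_prod (\<lambda>n. 1 - a * p ^ n)"
    by (simp add: abs_convergent_prod_conv_summable norm_mult norm_power)
  then show ?thesis
    by (rule abs_convergent_prod_imp_convergent_prod)
qed

lemma qpoch_tendsto:
  assumes "norm p < 1"
  shows "qpoch a p \<longlonglongrightarrow> qpoch_inf a p"
proof -
  \<comment> \<open>The library limit concerns products up to and including \<open>n\<close>, hence
    the shift by one.\<close>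
  have "(\<lambda>n. qpoch a p (Suc n)) \<longlonglongrightarrow> qpoch_inf a p"
    using convergent_prod_LIMSEQ[OF convergent_prod_qpoch[OF assms], of a]
    by (simp add: qpoch_def qpoch_inf_def lessThan_Suc_atMost)
  then show ?thesis
    by (rule LIMSEQ_imp_Suc)
qed

lemma qpoch_factor_nonzero:
  fixes a p :: complex
  assumes "norm p < 1" "norm a < 1"
  shows "1 - a * p ^ n \<noteq> 0"
proof -
  have "norm (a * p ^ n) \<le> norm a"
    using assms by (simp add: norm_mult norm_power mult_left_le power_le_one)
  then show ?thesis
    using assms by auto
qed

lemma qpoch_nonzero:
  assumes "norm p < 1" "norm a < 1"
  shows "qpoch a p n \<noteq> 0"
  using qpoch_factor_nonzero[OF assms] by (simp add: qpoch_def)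

lemma qpoch_inf_nonzero:
  assumes "norm p < 1" "norm a < 1"
  shows "qpoch_inf a p \<noteq> 0"
  unfolding qpoch_inf_def
  by (intro prodinf_nonzero convergent_prod_qpoch qpoch_factor_nonzero assms)

theorem jacobi_triple_product:
  assumes "p \<noteq> 0" "norm p < 1" "a \<noteq> 0"
  shows "theta p (- a) = qpoch_inf p p * qpoch_inf a p * qpoch_inf (p / a) p"
proof -
  let ?P = "qpoch_inf p p"
  \<comment> \<open>Extending the coefficients by 0 makes every finite identity a sum over all
    integers, as dominated convergence requires.\<close>
  define c where
    "c = (\<lambda>n k. if k \<in> {- int n..int n} then qbinomial p (2 * n) (nat (int n + k)) else 0)"
  have P: "?P \<noteq> 0"
    by (rule qpoch_inf_nonzero) (use assms in auto)
  have c_eq: "c n k = qpoch p p (2 * n) * inverse (qpoch p p (nat (int n + k))) *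
      inverse (qpoch p p (nat (int n - k)))" if "\<bar>k\<bar> \<le> int n" for n k
  proof -
    have "2 * n - nat (int n + k) = nat (int n - k)" "nat (int n + k) \<le> 2 * n"
      using that by auto
    then have "qbinomial p (2 * n) (nat (int n + k)) * qpoch p p (nat (int n + k)) *
        qpoch p p (nat (int n - k)) = qpoch p p (2 * n)"
      using qbinomial_mult_qpoch[of "nat (int n + k)" "2 * n" p] by simp
    then show ?thesis
      using that qpoch_nonzero[OF assms(2) assms(2)] by (auto simp: c_def field_simps)
  qed
  have lim: "qpoch p p \<longlonglongrightarrow> ?P"
    by (rule qpoch_tendsto[OF assms(2)])
  have inv_lim: "(\<lambda>n. inverse (qpoch p p n)) \<longlonglongrightarrow> inverse ?P"
    by (rule tendsto_inverse[OF lim P])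
  \<comment> \<open>Convergent sequences are bounded, and so are their inverses since the limit is
    nonzero. This bounds \<open>c n k\<close> independently of both \<open>n\<close> and
    \<open>k\<close>.\<close>
  obtain M where M: "M > 0" "\<And>n. norm (qpoch p p n) \<le> M"
    using convergent_imp_Bseq[of "qpoch p p"] lim unfolding Bseq_def convergent_def by blast
  obtain K where K: "K > 0" "\<And>n. norm (inverse (qpoch p p n)) \<le> K"
    using convergent_imp_Bseq[of "\<lambda>n. inverse (qpoch p p n)"] inv_lim
    unfolding Bseq_def convergent_def by blast
  have bound: "norm (c n k) \<le> M * K * K" for n k
  proof (cases "\<bar>k\<bar> \<le> int n")
    case True
    show ?thesis
      unfolding c_eq[OF True] norm_mult
      by (intro mult_mono mult_nonneg_nonneg) (use M K in \<open>auto simp: less_imp_le\<close>)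
  next
    case False
    then show ?thesis
      using M K by (auto simp: c_def)
  qed
  have c_lim: "(\<lambda>n. c n k) \<longlonglongrightarrow> inverse ?P" for k
  proof -
    have sub: "filterlim (\<lambda>n. nat (int n + l)) sequentially sequentially" for l :: int
      unfolding filterlim_at_top eventually_sequentially
    proof
      fix Z
      show "\<exists>N. \<forall>n\<ge>N. Z \<le> nat (int n + l)"
        by (rule exI[of _ "Z + nat \<bar>l\<bar>"]) auto
    qed
    have dbl: "filterlim (\<lambda>n. 2 * n) sequentially (sequentially :: nat filter)"
      by (rule filterlim_subseq) (auto simp: strict_mono_def)
    have "(\<lambda>n. qpoch p p (2 * n) * inverse (qpoch p p (nat (int n + k))) *
        inverse (qpoch p p (nat (int n - k)))) \<longlonglongrightarrow> ?P * inverse ?P * inverse ?P"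
      using filterlim_compose[OF lim dbl] filterlim_compose[OF inv_lim sub[of k]]
        filterlim_compose[OF inv_lim sub[of "- k"]]
      by (intro tendsto_mult) auto
    moreover have "eventually (\<lambda>n. c n k = qpoch p p (2 * n) *
        inverse (qpoch p p (nat (int n + k))) * inverse (qpoch p p (nat (int n - k)))) sequentially"
      unfolding eventually_sequentially
      by (rule exI[of _ "nat \<bar>k\<bar>"]) (auto intro!: c_eq)
    ultimately show ?thesis
      using P by (subst tendsto_cong) auto
  qed
  have "(\<lambda>n. qpoch a p n * qpoch (p / a) p n) \<longlonglongrightarrow> inverse ?P * theta p (- a)"
  \<comment> \<open>For a finite index set the limit in \<open>n\<close> is taken termwise; the
    M-test makes convergence over growing index sets uniform in \<open>n\<close>, so the two limits
    may be exchanged.\<close>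
  proof (rule swap_uniform_limit'[where F = "finite_subsets_at_top UNIV" and S = UNIV])
    show "\<forall>\<^sub>F X in finite_subsets_at_top UNIV.
        (\<lambda>n. \<Sum>k\<in>X. c n k * theta_term p (- a) k) \<longlonglongrightarrow>
        (\<Sum>k\<in>X. inverse ?P * theta_term p (- a) k)"
      by (intro always_eventually allI tendsto_sum tendsto_mult_right c_lim)
    show "((\<lambda>X. \<Sum>k\<in>X. inverse ?P * theta_term p (- a) k) \<longlongrightarrow> inverse ?P * theta p (- a))
        (finite_subsets_at_top UNIV)"
      using has_sum_cmult_right[OF has_sum_theta[of p "- a"]] assms unfolding has_sum_def by auto
    show "uniform_limit UNIV (\<lambda>X n. \<Sum>k\<in>X. c n k * theta_term p (- a) k)
        (\<lambda>n. qpoch a p n * qpoch (p / a) p n) (finite_subsets_at_top UNIV)"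
    proof (rule Weierstrass_m_test_general')
      show "norm (c n k * theta_term p (- a) k) \<le> M * K * K * norm (theta_term p (- a) k)" for n k
        unfolding norm_mult by (intro mult_right_mono bound) auto
      show "((\<lambda>k. c n k * theta_term p (- a) k) has_sum qpoch a p n * qpoch (p / a) p n) UNIV" for n
        by (rule has_sum_finite_neutralI[of "{- int n..int n}"])
          (auto simp: c_def finite_jacobi_triple_product[OF assms(1,3)] intro!: sum.cong)
      show "(\<lambda>k. M * K * K * norm (theta_term p (- a) k)) summable_on UNIV"
        by (intro summable_on_cmult_right abs_summable_theta_term) (use assms in auto)
    qed
  qed auto
  moreover have "(\<lambda>n. qpoch a p n * qpoch (p / a) p n) \<longlonglongrightarrow> qpoch_inf a p * qpoch_inf (p / a) p"
    by (intro tendsto_mult qpoch_tendsto assms)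
  ultimately have "inverse ?P * theta p (- a) = qpoch_inf a p * qpoch_inf (p / a) p"
    using LIMSEQ_unique by blast
  then show ?thesis
    using P by (simp add: field_simps)
qed

section \<open>Factoring the denominator and the numerator\<close>

lemma theta_mult_complement:
  assumes "Q \<noteq> 0" "norm Q < 1" "a * b = Q"
  shows "theta (Q ^ 2) a * theta (Q ^ 2) b = ramanujan_psi Q * ramanujan_f a b"
proof -
  have ab: "a \<noteq> 0" "b \<noteq> 0"
    using assms by auto
  have norms: "norm (Q ^ 2) < 1" "norm (Q ^ 4) < 1"
    using assms by (auto simp: norm_power power_less_one_iff)
  have args: "Q ^ 2 * a / b = Q * a ^ 2" "Q ^ 4 * a / b = Q ^ 3 * a ^ 2"
    "Q ^ 2 * a * b = Q ^ 3" "(Q ^ 2) ^ 2 = Q ^ 4"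
    using ab unfolding assms(3)[symmetric]
    by (simp_all add: divide_simps power2_eq_square power3_eq_cube power4_eq_xxxx)
  \<comment> \<open>Reflection identifies the coefficients of both products in
    \<open>theta_mult_theta\<close>. Their common value is \<open>ramanujan_psi Q\<close>, and what
    remains is the parity splitting of \<open>theta Q a\<close>.\<close>
  have "theta (Q ^ 4) (Q ^ 3) = theta (Q ^ 4) (Q ^ 4 / Q)"
    using assms(1) by (simp add: eval_nat_numeral)
  also have "\<dots> = theta (Q ^ 4) Q"
    using assms norms by (intro theta_reflect) auto
  finally have Q3: "theta (Q ^ 4) (Q ^ 3) = theta (Q ^ 4) Q" .
  have psi: "ramanujan_psi Q = theta (Q ^ 4) Q"
    unfolding ramanujan_psi_def using assms(1)
    by (subst ramanujan_f_eq_theta) (simp_all add: eval_nat_numeral)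
  have "theta (Q ^ 2) a * theta (Q ^ 2) b =
      theta (Q ^ 4) Q * (theta (Q ^ 4) (Q * a ^ 2) + a * theta (Q ^ 4) (Q ^ 3 * a ^ 2))"
    using theta_mult_theta[of "Q ^ 2" a b] assms ab norms
    unfolding args Q3 by (simp only: simp_thms) (simp add: algebra_simps)
  also have "theta (Q ^ 4) (Q * a ^ 2) + a * theta (Q ^ 4) (Q ^ 3 * a ^ 2) = ramanujan_f a b"
    using theta_even_odd[OF assms(1,2) ab(1)] ramanujan_f_eq_theta[OF ab] assms(3) by simp
  finally show ?thesis
    by (simp add: psi)
qed

lemma theta_square:
  assumes "p \<noteq> 0" "norm p < 1" "a \<noteq> 0"
  shows "theta p a ^ 2 = theta (p ^ 2) (a ^ 2) * theta (p ^ 2) p +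
    a * (theta (p ^ 2) (p * a ^ 2) * theta (p ^ 2) (p ^ 2))"
  using theta_mult_theta[OF assms assms(3)] assms(3) by (simp add: power2_eq_square mult.assoc)

text \<open>Separates even and odd squares in the sum of \<open>s ^ (n ^ 2)\<close>. The two series
  are the coefficients occurring in \<open>theta_square\<close> for
  \<open>p = s ^ 4\<close>.\<close>

lemma ramanujan_phi_split:
  assumes "s \<noteq> 0" "norm s < 1"
  shows "ramanujan_phi s = theta (s ^ 8) (s ^ 4) + s * theta (s ^ 8) (s ^ 8)"
proof -
  have "norm (s ^ 2) < 1"
    using assms by (simp add: norm_power power_less_one_iff)
  then have "theta (s ^ 2) s = theta (s ^ 8) (s ^ 4) + s * theta (s ^ 8) (s ^ 8)"
    using theta_even_odd[of "s ^ 2" s] assms by (simp flip: power_mult power_add)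
  then show ?thesis
    unfolding ramanujan_phi_def using assms by (simp add: ramanujan_f_eq_theta power2_eq_square)
qed

text \<open>Replacing \<open>y\<close> and \<open>s\<close> by their negatives leaves \<open>a\<close> and \<open>b\<close> unchanged, which is how
  this identity yields both the sum and the difference of \<open>1 / X\<close> and \<open>X\<close>.\<close>
lemma theta_squares_sum:
  assumes s: "s \<noteq> 0" "norm s < 1" and y: "y * a = s" "y * z = s ^ 2" and ab: "a * b = s ^ 2"
  shows "theta (s ^ 4) (- b) ^ 2 + y * theta (s ^ 4) (- a) ^ 2 =
    ramanujan_phi (- s) * ramanujan_f y z"
proof -
  have nz: "y \<noteq> 0" "z \<noteq> 0" "a \<noteq> 0" "b \<noteq> 0"
    using s y ab by auto
  have norms: "norm (s ^ 2) < 1" "norm (s ^ 4) < 1" "norm (s ^ 8) < 1"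
    using s by (auto simp: norm_power power_less_one_iff)
  \<comment> \<open>Reflection with base \<open>s ^ 8\<close> expresses the squares for both
    \<open>- a\<close> and \<open>- b\<close> through \<open>U\<close> and \<open>V\<close>, with
    their roles exchanged.\<close>
  define U V where "U = theta (s ^ 8) (a ^ 2)" and "V = theta (s ^ 8) (s ^ 4 * a ^ 2)"
  have b: "b = s ^ 2 / a"
    using ab nz by (simp add: field_simps)
  have y_eq: "y = s / a"
    using y nz by (simp add: field_simps)
  have "theta (s ^ 8) (s ^ 4 * b ^ 2) = theta (s ^ 8) (s ^ 8 / a ^ 2)"
    by (simp add: b power_divide flip: power_mult power_add)
  also have "\<dots> = U"
    unfolding U_def using s nz norms by (intro theta_reflect) auto
  finally have b_U: "theta (s ^ 8) (s ^ 4 * b ^ 2) = U" .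
  have "b ^ 2 = s ^ 4 / a ^ 2"
    by (simp add: b power_divide flip: power_mult)
  also have "\<dots> = s ^ 4 * s ^ 4 / (s ^ 4 * a ^ 2)"
    by (rule mult_divide_mult_cancel_left[symmetric]) (use s in simp)
  also have "s ^ 4 * s ^ 4 = s ^ 8"
    by (simp flip: power_add)
  finally have "theta (s ^ 8) (b ^ 2) = theta (s ^ 8) (s ^ 8 / (s ^ 4 * a ^ 2))"
    by simp
  also have "\<dots> = V"
    unfolding V_def using s nz norms by (intro theta_reflect) auto
  finally have b_V: "theta (s ^ 8) (b ^ 2) = V" .
  have sq: "theta (s ^ 4) c ^ 2 = theta (s ^ 8) (c ^ 2) * theta (s ^ 8) (s ^ 4) +
      c * (theta (s ^ 8) (s ^ 4 * c ^ 2) * theta (s ^ 8) (s ^ 8))" if "c \<noteq> 0" for c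
    using theta_square[of "s ^ 4" c] s norms that by (simp flip: power_mult)
  have "ramanujan_f y z = theta (s ^ 2) y"
    using ramanujan_f_eq_theta[OF nz(1,2)] y(2) by simp
  also have "\<dots> = theta ((s ^ 2) ^ 4) (s ^ 2 * y ^ 2) + y * theta ((s ^ 2) ^ 4) ((s ^ 2) ^ 3 * y ^ 2)"
    using s nz norms by (intro theta_even_odd) auto
  also have "s ^ 2 * y ^ 2 = b ^ 2"
    by (simp add: b y_eq power_divide flip: power_mult power_add)
  also have "(s ^ 2) ^ 3 * y ^ 2 = s ^ 4 * b ^ 2"
    by (simp add: b y_eq power_divide flip: power_mult power_add)
  finally have f: "ramanujan_f y z = V + y * U"
    using b_U b_V by (simp flip: power_mult)
  have phi: "ramanujan_phi (- s) = theta (s ^ 8) (s ^ 4) - s * theta (s ^ 8) (s ^ 8)"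
    using ramanujan_phi_split[of "- s"] s by simp
  \<comment> \<open>With \<open>y * a = s\<close>, this makes the coefficient of
    \<open>theta (s ^ 8) (s ^ 8)\<close> equal to \<open>- s * (V + y * U)\<close>. That of
    \<open>theta (s ^ 8) (s ^ 4)\<close> is \<open>V + y * U\<close>, so the sum factors.\<close>
  have "y * s = b"
    by (simp add: b y_eq power2_eq_square)
  then show ?thesis
    unfolding f phi sq[of "- b", simplified, OF nz(4)] sq[of "- a", simplified, OF nz(3)] b_U b_V
      U_def[symmetric] V_def[symmetric]
    using y(1) by (auto simp: algebra_simps)
qed

lemma theta_nonzero:
  assumes "p \<noteq> 0" "norm p < 1" "a \<noteq> 0" "norm a < 1" "norm (p / a) < 1"
  shows "theta p (- a) \<noteq> 0"
  using assms by (simp add: jacobi_triple_product qpoch_inf_nonzero)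

text \<open>The factor \<open>qpoch_inf p p\<close> is common to both triple products and nonzero,
  so it cancels.\<close>

lemma qpoch_inf_quotient:
  assumes "p \<noteq> 0" "norm p < 1" "a \<noteq> 0" "b \<noteq> 0" "a * a' = p" "b * b' = p"
  shows "qpoch_inf_list [a, a'] p / qpoch_inf_list [b, b'] p = theta p (- a) / theta p (- b)"
proof -
  have "a' = p / a" "b' = p / b"
    using assms by (auto simp: field_simps)
  moreover have "qpoch_inf p p \<noteq> 0"
    using assms(2) by (intro qpoch_inf_nonzero)
  ultimately show ?thesis
    using assms(1-4) by (simp add: qpoch_inf_list_def jacobi_triple_product mult.assoc)
qed

theorem theorem2p1:
  fixes q t :: complex and k :: nat
  assumes "norm q < 1"
    and "t ^ 4 = q"
    and "k \<in> {1..8}"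
  shows "X_quot q t k = t ^ (2 * k - 1) *
           (ramanujan_f (- (q ^ (9 - k))) (- (q ^ (25 + k))) /
            ramanujan_f (- (q ^ (8 + k))) (- (q ^ (26 - k)))) \<and>
         1 / X_quot q t k + X_quot q t k =
           ramanujan_phi (- (t ^ 34)) *
             ramanujan_f (t ^ (2 * (2 * k - 1))) (t ^ (2 * (35 - 2 * k))) /
           (t ^ (2 * k - 1) * ramanujan_psi (q ^ 17) *
             ramanujan_f (- (q ^ (9 - k))) (- (q ^ (8 + k)))) \<and>
         1 / X_quot q t k - X_quot q t k =
           ramanujan_phi (t ^ 34) *
             ramanujan_f (- (t ^ (2 * (2 * k - 1)))) (- (t ^ (2 * (35 - 2 * k)))) /
           (t ^ (2 * k - 1) * ramanujan_psi (q ^ 17) *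
             ramanujan_f (- (q ^ (9 - k))) (- (q ^ (8 + k))))"
\<comment> \<open>Here \<open>t = 0\<close>, so \<open>t ^ (2 * k - 1)\<close> vanishes and all
  sides are 0 under the convention for division by 0. The theta lemmas require nonzero
  arguments.\<close>
proof (cases "q = 0")
  case True
  then have t0: "t ^ (2 * k - 1) = 0"
    using assms(2,3) by simp
  show ?thesis
    unfolding X_quot_def t0 by simp
next
  case False
  have k: "1 \<le> k" "k \<le> 8"
    using assms(3) by auto
  \<comment> \<open>In powers of q: \<open>s\<close> is q^(17/2), \<open>x\<close> is q^((2k-1)/4),
    \<open>y\<close> is q^((2k-1)/2) and \<open>z\<close> is q^((35-2k)/2).\<close>
  define s x y z a b where "s = t ^ 34" and "x = t ^ (2 * k - 1)"
    and "y = t ^ (2 * (2 * k - 1))" and "z = t ^ (2 * (35 - 2 * k))"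
    and "a = q ^ (9 - k)" and "b = q ^ (8 + k)"
  have t: "t \<noteq> 0" "norm t < 1"
    using False assms(1,2) by (auto simp: norm_power power_less_one_iff)
  have s: "s \<noteq> 0" "norm s < 1"
    using t by (auto simp: s_def norm_power power_less_one_iff)
  have p: "s ^ 4 \<noteq> 0" "norm (s ^ 4) < 1" and Q: "s ^ 2 \<noteq> 0" "norm (s ^ 2) < 1"
    using s by (auto simp: norm_power power_less_one_iff)
  have nz: "x \<noteq> 0" "a \<noteq> 0" "b \<noteq> 0"
    using t False by (auto simp: x_def a_def b_def)
  have q34: "q ^ 34 = s ^ 4" and q17: "q ^ 17 = s ^ 2"
    by (simp_all add: s_def flip: assms(2) power_mult)
  have y_x: "y = x ^ 2"
    by (simp add: x_def y_def mult.commute flip: power_mult)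
  \<comment> \<open>Exponents of \<open>t\<close> in \<open>y * a\<close> and \<open>y * z\<close>;
    the bounds on \<open>k\<close> prevent truncated subtraction.\<close>
  have "2 * (2 * k - 1) + 4 * (9 - k) = 34" "2 * (2 * k - 1) + 2 * (35 - 2 * k) = 68"
    using k by auto
  then have ya: "y * a = s" and yz: "y * z = s ^ 2"
    by (simp_all add: y_def z_def a_def s_def flip: assms(2) power_mult power_add)
  have ab: "a * b = s ^ 2" and aa': "a * q ^ (25 + k) = s ^ 4" and bb': "b * q ^ (26 - k) = s ^ 4"
    using k by (simp_all add: a_def b_def flip: q17 q34 power_add)
  define A B where "A = theta (s ^ 4) (- a)" and "B = theta (s ^ 4) (- b)"
  have small: "norm (q ^ n) < 1" if "n > 0" for n
    using that assms(1) by (simp add: norm_power power_less_one_iff)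
  have "s ^ 4 / a = q ^ (25 + k)" "s ^ 4 / b = q ^ (26 - k)"
    using aa' bb' nz by (auto simp: field_simps)
  then have AB: "A \<noteq> 0" "B \<noteq> 0"
    unfolding A_def B_def
    using theta_nonzero[OF p nz(2)] theta_nonzero[OF p nz(3)] small[of "9 - k"] small[of "8 + k"]
      small[of "25 + k"] small[of "26 - k"] k
    by (simp_all flip: a_def b_def)
  have X: "X_quot q t k = x * (A / B)"
    unfolding X_quot_def q34 A_def B_def x_def
    using qpoch_inf_quotient[OF p nz(2,3) aa' bb'] by (simp add: a_def b_def)
  have fA: "ramanujan_f (- a) (- (q ^ (25 + k))) = A"
    and fB: "ramanujan_f (- b) (- (q ^ (26 - k))) = B"
    using nz aa' bb' False by (simp_all add: ramanujan_f_eq_theta A_def B_def)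
  have psi: "A * B = ramanujan_psi (s ^ 2) * ramanujan_f (- a) (- b)"
    using theta_mult_complement[OF Q, of "- a" "- b"] ab
    by (simp add: A_def B_def flip: power_mult)
  have plus: "B ^ 2 + y * A ^ 2 = ramanujan_phi (- s) * ramanujan_f y z"
    unfolding A_def B_def by (rule theta_squares_sum[OF s ya yz ab])
  \<comment> \<open>The sign of \<open>z\<close> changes along with those of \<open>y\<close> and
    \<open>s\<close>, which preserves \<open>y * z = s ^ 2\<close>.\<close>
  have minus: "B ^ 2 - y * A ^ 2 = ramanujan_phi s * ramanujan_f (- y) (- z)"
    using theta_squares_sum[of "- s" "- y" a "- z" b] s ya yz ab by (simp add: A_def B_def)
  have "1 / (x * (A / B)) + x * (A / B) = (B ^ 2 + y * A ^ 2) / (x * (A * B))"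
    "1 / (x * (A / B)) - x * (A / B) = (B ^ 2 - y * A ^ 2) / (x * (A * B))"
    using AB nz by (simp_all add: y_x field_simps power2_eq_square)
  then show ?thesis
    unfolding X q17 plus minus psi
    unfolding s_def[symmetric] x_def[symmetric] y_def[symmetric] z_def[symmetric]
      a_def[symmetric] b_def[symmetric] fA fB
    by (simp add: mult.assoc)
qed

end
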